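(* Let $(X,\Sigma_X)$ and $(Y,\Sigma_Y)$ be measurable spaces. Let $\mu$ be a probability measure on $X$ and let $\mathcal{V}: X\times\Sigma_Y\to[0,1]$ be a Markov kernel. Let $\mathcal{M}$ be the probability measure on $X\times Y$ defined by $$\mathcal{M}(d\mathbf{q},d\mathbf{v})=\mathcal{V}(\mathbf{q},d\mathbf{v})\,\mu(d\mathbf{q}).$$ Suppose there exists a measurable mapping $S:X\times Y\to X\times Y$ such that (P1) $S$ is an involution, i.e. $S\circ S=I$; (P2) the pushforward $S^*\mathcal{M}$ is absolutely continuous with respect to $\mathcal{M}$. Let $\hat\alpha:X\times Y\to\mathbb{R}$ be defined by $$\hat\alpha(\mathbf{q},\mathbf{v}) := 1\wedge\frac{dS^*\mathcal{M}}{d\mathcal{M}}(\mathbf{q},\mathbf{v}),\qquad(\mathbf{q},\mathbf{v})\in X\times Y,$$ and let $P:X\times\Sigma_X\to[0,1]$ be the Markov transition kernel defined, for $\mathbf{q}\in X$, by $$P(\mathbf{q},d\tilde{\mathbf{q}})=\int_Y\hat\alpha(\mathbf{q},\mathbf{v})\,\delta_{\Pi_1\circ S(\mathbf{q},\mathbf{v})}(d\tilde{\mathbf{q}})\,\mathcal{V}(\mathbf{q},d\mathbf{v})+\delta_{\mathbf{q}}(d\tilde{\mathbf{q}})\int_Y(1-\hat\alpha(\mathbf{q},\mathbf{v}))\,\mathcal{V}(\mathbf{q},d\mathbf{v}).$$ Then $P$ satisfies detailed balance with respect to $\mu$, i.e. $$P(\mathbf{q},d\tilde{\mathbf{q}})\,\mu(d\mathbf{q})=P(\tilde{\mathbf{q}},d\mathbf{q})\,\mu(d\tilde{\mathbf{q}})$$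 as measures on $X\times X$; in particular $\mu$ is $P$-invariant, i.e. $\int_X P(\mathbf{q},\cdot)\,\mu(d\mathbf{q})=\mu$.
   Context: $\Pi_1:X\times Y\to X$ is the projection $\Pi_1(\mathbf{q},\mathbf{v})=\mathbf{q}$. For a measurable map $\phi$ and a measure $\nu$, the pushforward is $\phi^*\nu(A)=\nu(\phi^{-1}(A))$. $dS^*\mathcal{M}/d\mathcal{M}$ denotes the Radon–Nikodym derivative, $a\wedge b=\min(a,b)$, and $\delta_x$ is the Dirac measure at $x$. Product spaces carry the product $\sigma$-algebra. *)

theory Defs
  imports "HOL-Probability.Probability"
begin

text \<open>
  Measurable spaces are represented by measures of which only the carrier and the sigma-algebra
  matter. A Markov kernel from \<open>X\<close> to \<open>Y\<close> is a map in \<open>X \<rightarrow>\<^sub>M prob_algebra Y\<close>.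
\<close>

text \<open>The measure \<open>K(q, dv) \<mu>(dq)\<close> on \<open>X \<times> Y\<close>.\<close>

definition kernel_product ::
  "'a measure \<Rightarrow> 'b measure \<Rightarrow> 'a measure \<Rightarrow> ('a \<Rightarrow> 'b measure) \<Rightarrow> ('a \<times> 'b) measure" where
  "kernel_product X Y \<mu> K = \<mu> \<bind> (\<lambda>q. K q \<bind> (\<lambda>v. return (X \<Otimes>\<^sub>M Y) (q, v)))"

text \<open>
  \<open>\<rho>\<close> is a version of a Radon-Nikodym derivative, with values in \<open>[0, \<infinity>]\<close>. The minimum is taken
  before the conversion to a real number, since \<^const>\<open>enn2real\<close> sends \<open>\<infinity>\<close> to \<open>0\<close>.
\<close>

definition accept_prob :: "('c \<Rightarrow> ennreal) \<Rightarrow> 'c \<Rightarrow> real" where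
  "accept_prob \<rho> z = enn2real (min 1 (\<rho> z))"

text \<open>
  \<^const>\<open>measure_of\<close> yields the zero measure if the given set function is not countably additive;
  this degenerate case is excluded wherever the result is known to be a Markov kernel.
\<close>

definition accept_reject_kernel ::
  "'a measure \<Rightarrow> ('a \<Rightarrow> 'b measure) \<Rightarrow> ('a \<times> 'b \<Rightarrow> 'a \<times> 'b) \<Rightarrow> ('a \<times> 'b \<Rightarrow> real) \<Rightarrow> 'a \<Rightarrow> 'a measure"
  where
  "accept_reject_kernel X V S \<alpha> q = measure_of (space X) (sets X) (\<lambda>A.
     (\<integral>\<^sup>+ v. ennreal (\<alpha> (q, v)) * emeasure (return X (fst (S (q, v)))) A \<partial>V q)
     + emeasure (return X q) A * (\<integral>\<^sup>+ v. ennreal (1 - \<alpha> (q, v)) \<partial>V q))"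

text \<open>
  With the two coordinates written \<open>(q, q')\<close>, the right-hand side is \<open>P(q', dq) \<mu>(dq')\<close>: the image
  of \<open>P(q, dq') \<mu>(dq)\<close> under exchange of the coordinates.
\<close>

definition detailed_balance :: "'a measure \<Rightarrow> 'a measure \<Rightarrow> ('a \<Rightarrow> 'a measure) \<Rightarrow> bool" where
  "detailed_balance X \<mu> P \<longleftrightarrow>
     kernel_product X X \<mu> P
       = distr (kernel_product X X \<mu> P) (X \<Otimes>\<^sub>M X) (\<lambda>(q', q). (q, q'))"

definition invariant_measure :: "'a measure \<Rightarrow> ('a \<Rightarrow> 'a measure) \<Rightarrow> bool" where
  "invariant_measure \<mu> P \<longleftrightarrow> \<mu> \<bind> P = \<mu>"

end

theory Submission
  imports Defs
begin

text \<open>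
  Write \<open>a = min 1 \<rho>\<close>. As \<open>S\<close> is an involution, pushing \<open>\<M>\<close> forward twice along \<open>S\<close> gives
  \<open>\<rho> z * \<rho> (S z) = 1\<close> almost everywhere, so \<open>\<rho> z * a (S z) = a z\<close>. Hence the measure \<open>a \<M>\<close> is
  \<open>S\<close>-invariant. The accepted part of \<open>P(q, dq') \<mu>(dq)\<close> is the image of \<open>a \<M>\<close> under
  \<open>z \<mapsto> (fst z, fst (S z))\<close>, and precomposing this map with \<open>S\<close> exchanges the two coordinates. The
  rejected part lives on the diagonal.
\<close>

section \<open>Invariance of the truncated density under the involution\<close>

lemma (in sigma_finite_measure) nn_integral_involution:
  assumes S[measurable]: "S \<in> M \<rightarrow>\<^sub>M M" and inv: "\<And>z. z \<in> space M \<Longrightarrow> S (S z) = z"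
    and \<rho>[measurable]: "\<rho> \<in> borel_measurable M" and dens: "density M \<rho> = distr M M S"
    and g[measurable]: "g \<in> borel_measurable M"
  shows "(\<integral>\<^sup>+z. min 1 (\<rho> z) * g (S z) \<partial>M) = (\<integral>\<^sup>+z. min 1 (\<rho> z) * g z \<partial>M)"
proof -
  \<comment> \<open>The density hypothesis as a change of variables: composing the integrand with
    \<open>S\<close> amounts to weighting it with \<open>\<rho>\<close>.\<close>
  have push: "(\<integral>\<^sup>+z. h (S z) \<partial>M) = (\<integral>\<^sup>+z. \<rho> z * h z \<partial>M)"
    if [measurable]: "h \<in> borel_measurable M" for h
    using arg_cong[OF dens, of "\<lambda>N. integral\<^sup>N N h"]
    by (simp add: nn_integral_density nn_integral_distr)
  \<comment> \<open>Read from right to left, \<open>push\<close> trades the factor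
    \<open>\<rho> z\<close> for composition with \<open>S\<close>. Doing this twice, and cancelling
    \<open>S (S z)\<close> in between, removes both factors.\<close>
  have "density M (\<lambda>z. \<rho> z * \<rho> (S z)) = density M (\<lambda>_. 1)"
  proof (rule measure_eqI)
    fix A assume "A \<in> sets (density M (\<lambda>z. \<rho> z * \<rho> (S z)))"
    then have [measurable]: "A \<in> sets M" by simp
    have "emeasure (density M (\<lambda>z. \<rho> z * \<rho> (S z))) A
        = (\<integral>\<^sup>+z. \<rho> z * (\<rho> (S z) * indicator A z) \<partial>M)"
      by (simp add: emeasure_density mult.assoc)
    also have "\<dots> = (\<integral>\<^sup>+z. \<rho> (S (S z)) * indicator A (S z) \<partial>M)"
      by (subst push[symmetric]) simp_all
    also have "\<dots> = (\<integral>\<^sup>+z. \<rho> z * indicator A (S z) \<partial>M)"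
      by (intro nn_integral_cong) (simp add: inv)
    also have "\<dots> = (\<integral>\<^sup>+z. indicator A (S (S z)) \<partial>M)"
      by (subst push[symmetric]) simp_all
    also have "\<dots> = (\<integral>\<^sup>+z. indicator A z \<partial>M)"
      by (intro nn_integral_cong) (simp add: inv)
    finally show "emeasure (density M (\<lambda>z. \<rho> z * \<rho> (S z))) A = emeasure (density M (\<lambda>_. 1)) A"
      by (simp add: emeasure_density)
  qed simp
  \<comment> \<open>Sigma-finiteness makes densities unique almost everywhere. As 0 times infinity
    is 0 in \<open>ennreal\<close>, the equation also forces \<open>\<rho>\<close> to be finite and
    nonzero almost everywhere.\<close>
  then have AE: "AE z in M. \<rho> z * \<rho> (S z) = 1"
    by (subst (asm) density_unique_iff) simp_all
  \<comment> \<open>Writing \<open>z\<close> as \<open>S (S z)\<close> inside \<open>\<rho>\<close>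
    exhibits the whole integrand as a function of \<open>S z\<close>, the form to which
    \<open>push\<close> applies.\<close>
  have "(\<integral>\<^sup>+z. min 1 (\<rho> z) * g (S z) \<partial>M) = (\<integral>\<^sup>+z. min 1 (\<rho> (S (S z))) * g (S z) \<partial>M)"
    by (intro nn_integral_cong) (simp add: inv)
  also have "\<dots> = (\<integral>\<^sup>+z. \<rho> z * (min 1 (\<rho> (S z)) * g z) \<partial>M)"
    by (rule push) simp
  also have "\<dots> = (\<integral>\<^sup>+z. min 1 (\<rho> z) * g z \<partial>M)"
  proof (rule nn_integral_cong_AE, use AE in eventually_elim)
    fix z assume *: "\<rho> z * \<rho> (S z) = 1"
    have "mono ((*) (\<rho> z))"
      by (intro monoI mult_left_mono) simp_all
    \<comment> \<open>A monotone map commutes with \<open>min\<close>, so the factor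
      \<open>\<rho> z\<close> moves inside and turns the pair 1, \<open>\<rho> (S z)\<close> into
      \<open>\<rho> z\<close>, 1.\<close>
    from min_of_mono[OF this, of 1 "\<rho> (S z)"] have "\<rho> z * min 1 (\<rho> (S z)) = min 1 (\<rho> z)"
      by (simp add: * min.commute)
    then show "\<rho> z * (min 1 (\<rho> (S z)) * g z) = min 1 (\<rho> z) * g z"
      by (metis mult.assoc)
  qed
  finally show ?thesis .
qed

section \<open>Integration against a kernel product\<close>

context
  fixes X \<mu> :: "'a measure" and Y :: "'b measure" and K :: "'a \<Rightarrow> 'b measure"
  assumes \<mu>: "prob_space \<mu>" and sets_\<mu>: "sets \<mu> = sets X"
    and K: "K \<in> X \<rightarrow>\<^sub>M prob_algebra Y"
begin

lemma measurable_kernel_return: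
  "(\<lambda>q. K q \<bind> (\<lambda>v. return (X \<Otimes>\<^sub>M Y) (q, v))) \<in> X \<rightarrow>\<^sub>M prob_algebra (X \<Otimes>\<^sub>M Y)"
  using K by (rule measurable_bind_prob_space2) simp

lemma kernel_product_in_prob_algebra:
  "kernel_product X Y \<mu> K \<in> space (prob_algebra (X \<Otimes>\<^sub>M Y))"
proof -
  have "\<mu> \<in> space (prob_algebra X)"
    using \<mu> sets_\<mu> by (simp add: space_prob_algebra)
  from prob_space_bind'[OF this measurable_kernel_return] sets_bind'[OF this measurable_kernel_return]
  show ?thesis by (simp add: kernel_product_def space_prob_algebra)
qed

lemma sets_kernel_product: "sets (kernel_product X Y \<mu> K) = sets (X \<Otimes>\<^sub>M Y)"
  and prob_space_kernel_product: "prob_space (kernel_product X Y \<mu> K)"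
  using kernel_product_in_prob_algebra by (simp_all add: space_prob_algebra)

text \<open>Fubini for kernels: each of the two binds contributes one integral, and integrating
  against the innermost Dirac measure is evaluation at \<open>(q, v)\<close>.\<close>

lemma nn_integral_kernel_product:
  assumes f[measurable]: "f \<in> borel_measurable (X \<Otimes>\<^sub>M Y)"
  shows "(\<integral>\<^sup>+z. f z \<partial>kernel_product X Y \<mu> K) = (\<integral>\<^sup>+q. \<integral>\<^sup>+v. f (q, v) \<partial>K q \<partial>\<mu>)"
proof -
  have "(\<integral>\<^sup>+z. f z \<partial>kernel_product X Y \<mu> K)
      = (\<integral>\<^sup>+q. \<integral>\<^sup>+z. f z \<partial>(K q \<bind> (\<lambda>v. return (X \<Otimes>\<^sub>M Y) (q, v))) \<partial>\<mu>)"
    unfolding kernel_product_def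
    using measurable_prob_algebraD[OF measurable_kernel_return]
    by (intro nn_integral_bind[OF f]) (simp add: measurable_cong_sets[OF sets_\<mu> refl])
  also have "\<dots> = (\<integral>\<^sup>+q. \<integral>\<^sup>+v. f (q, v) \<partial>K q \<partial>\<mu>)"
  proof (rule nn_integral_cong)
    fix q assume "q \<in> space \<mu>"
    then have q[measurable]: "q \<in> space X" by (simp add: sets_eq_imp_space_eq[OF sets_\<mu>])
    have sK[measurable_cong]: "sets (K q) = sets Y"
      using measurable_space[OF K q] by (simp add: space_prob_algebra)
    have "(\<lambda>v. return (X \<Otimes>\<^sub>M Y) (q, v)) \<in> K q \<rightarrow>\<^sub>M subprob_algebra (X \<Otimes>\<^sub>M Y)"
      by measurable
    then show "(\<integral>\<^sup>+z. f z \<partial>(K q \<bind> (\<lambda>v. return (X \<Otimes>\<^sub>M Y) (q, v)))) = (\<integral>\<^sup>+v. f (q, v) \<partial>K q)"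
      by (subst nn_integral_bind[OF f])
        (auto intro!: nn_integral_cong nn_integral_return
          simp: space_pair_measure q sets_eq_imp_space_eq[OF sK])
  qed
  finally show ?thesis .
qed

lemma emeasure_kernel_product:
  assumes A[measurable]: "A \<in> sets (X \<Otimes>\<^sub>M Y)"
  shows "emeasure (kernel_product X Y \<mu> K) A = (\<integral>\<^sup>+q. emeasure (K q) (Pair q -` A) \<partial>\<mu>)"
proof -
  have "emeasure (kernel_product X Y \<mu> K) A = (\<integral>\<^sup>+z. indicator A z \<partial>kernel_product X Y \<mu> K)"
    by (simp add: sets_kernel_product)
  also have "\<dots> = (\<integral>\<^sup>+q. \<integral>\<^sup>+v. indicator A (q, v) \<partial>K q \<partial>\<mu>)"
    by (rule nn_integral_kernel_product) simp
  also have "\<dots> = (\<integral>\<^sup>+q. emeasure (K q) (Pair q -` A) \<partial>\<mu>)"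
  proof (rule nn_integral_cong)
    fix q assume "q \<in> space \<mu>"
    then have q: "q \<in> space X" by (simp add: sets_eq_imp_space_eq[OF sets_\<mu>])
    have "Pair q -` A \<in> sets (K q)"
      using measurable_space[OF K q] sets_Pair1[OF A] by (simp add: space_prob_algebra)
    then show "(\<integral>\<^sup>+v. indicator A (q, v) \<partial>K q) = emeasure (K q) (Pair q -` A)"
      by (simp add: indicator_def del: nn_integral_indicator flip: nn_integral_indicator)
  qed
  finally show ?thesis .
qed

end

section \<open>From detailed balance to invariance\<close>

text \<open>The second marginal of \<open>kernel_product X X \<mu> P\<close> is
  \<open>\<mu> \<bind> P\<close> and the first is \<open>\<mu>\<close>, because every
  \<open>P q\<close> has mass 1. Symmetry under the swap makes the two marginals equal.\<close>

lemma detailed_balance_imp_invariant: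
  assumes \<mu>: "prob_space \<mu>" "sets \<mu> = sets X" and P: "P \<in> X \<rightarrow>\<^sub>M prob_algebra X"
    and db: "detailed_balance X \<mu> P"
  shows "invariant_measure \<mu> P"
  unfolding invariant_measure_def
proof (rule measure_eqI)
  have in_prob: "\<mu> \<in> space (prob_algebra X)"
    using \<mu> by (simp add: space_prob_algebra)
  note space_\<mu> = sets_eq_imp_space_eq[OF \<mu>(2)]
  show "sets (\<mu> \<bind> P) = sets \<mu>"
    using sets_bind'[OF in_prob P] \<mu>(2) by simp
  have space_P: "space (P q) = space X" "emeasure (P q) (space X) = 1" if "q \<in> space X" for q
    using measurable_space[OF P that] prob_space.emeasure_space_1[of "P q"]
    by (auto simp: space_prob_algebra dest: sets_eq_imp_space_eq)
  fix A assume "A \<in> sets (\<mu> \<bind> P)"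
  then have A[measurable]: "A \<in> sets X" using sets_bind'[OF in_prob P] by simp
  let ?N = "kernel_product X X \<mu> P"
  have "emeasure (\<mu> \<bind> P) A = (\<integral>\<^sup>+q. emeasure (P q) A \<partial>\<mu>)"
    by (rule emeasure_bind_prob_algebra[OF in_prob P A])
  also have "\<dots> = emeasure ?N (space X \<times> A)"
    by (subst emeasure_kernel_product[OF \<mu> P])
      (auto intro!: nn_integral_cong arg_cong2[of _ _ _ _ emeasure] simp: space_\<mu>)
  also have "\<dots> = emeasure (distr ?N (X \<Otimes>\<^sub>M X) (\<lambda>(q', q). (q, q'))) (space X \<times> A)"
    using db unfolding detailed_balance_def by simp
  also have "\<dots> = emeasure ?N (A \<times> space X)"
    using sets.sets_into_space[OF A]
    by (subst emeasure_distr)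
      (auto intro!: arg_cong2[of _ _ _ _ emeasure]
        simp: measurable_cong_sets[OF sets_kernel_product[OF \<mu> P] refl] space_pair_measure
          sets_eq_imp_space_eq[OF sets_kernel_product[OF \<mu> P]])
  also have "\<dots> = (\<integral>\<^sup>+q. indicator A q \<partial>\<mu>)"
    by (subst emeasure_kernel_product[OF \<mu> P])
      (auto intro!: nn_integral_cong simp: space_\<mu> space_P indicator_def)
  finally show "emeasure (\<mu> \<bind> P) A = emeasure \<mu> A"
    by (simp add: \<mu>(2))
qed

section \<open>The accept-reject kernel for a general acceptance function\<close>

context
  fixes X :: "'a measure" and Y :: "'b measure" and V :: "'a \<Rightarrow> 'b measure"
    and S :: "'a \<times> 'b \<Rightarrow> 'a \<times> 'b" and \<alpha> :: "'a \<times> 'b \<Rightarrow> real"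
  assumes V: "V \<in> X \<rightarrow>\<^sub>M prob_algebra Y"
    and S[measurable]: "S \<in> X \<Otimes>\<^sub>M Y \<rightarrow>\<^sub>M X \<Otimes>\<^sub>M Y"
    and \<alpha>[measurable]: "\<alpha> \<in> borel_measurable (X \<Otimes>\<^sub>M Y)"
    and \<alpha>_01: "\<And>z. 0 \<le> \<alpha> z" "\<And>z. \<alpha> z \<le> 1"
begin

lemma measurable_nn_integral_V:
  assumes "case_prod f \<in> borel_measurable (X \<Otimes>\<^sub>M Y)"
  shows "(\<lambda>q. \<integral>\<^sup>+v. f q v \<partial>V q) \<in> borel_measurable X"
  using assms by (rule nn_integral_measurable_subprob_algebra2[OF _ measurable_prob_algebraD[OF V]])

lemma V_kernel:
  assumes "q \<in> space X"
  shows "sets (V q) = sets Y" "prob_space (V q)"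
  using measurable_space[OF V assms] by (simp_all add: space_prob_algebra)

text \<open>The set function in the definition is a mixture of Dirac measures, hence countably
  additive, so \<open>measure_of\<close> does not fall back to the zero measure. On measurable sets
  the Dirac masses are indicators.\<close>

lemma emeasure_accept_reject_kernel:
  assumes q[measurable]: "q \<in> space X" and A: "A \<in> sets X"
  shows "emeasure (accept_reject_kernel X V S \<alpha> q) A =
     (\<integral>\<^sup>+v. ennreal (\<alpha> (q, v)) * indicator A (fst (S (q, v))) \<partial>V q)
     + indicator A q * (\<integral>\<^sup>+v. ennreal (1 - \<alpha> (q, v)) \<partial>V q)"
proof -
  note [measurable_cong] = V_kernel(1)[OF q]
  let ?r = "\<integral>\<^sup>+v. ennreal (1 - \<alpha> (q, v)) \<partial>V q"
  let ?m = "\<lambda>A. (\<integral>\<^sup>+v. ennreal (\<alpha> (q, v)) * emeasure (return X (fst (S (q, v)))) A \<partial>V q)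
     + emeasure (return X q) A * ?r"
  have "countably_additive (sets X) ?m"
  proof (rule countably_additiveI)
    fix F :: "nat \<Rightarrow> 'a set"
    assume F: "range F \<subseteq> sets X" "disjoint_family F"
    then have [measurable]: "F i \<in> sets X" for i by auto
    have suminf_return: "(\<Sum>i. emeasure (return X x) (F i)) = emeasure (return X x) (\<Union>i. F i)" for x
      using F by (intro suminf_emeasure) simp_all
    have "(\<Sum>i. ?m (F i)) = (\<Sum>i. \<integral>\<^sup>+v. ennreal (\<alpha> (q, v)) * emeasure (return X (fst (S (q, v)))) (F i) \<partial>V q)
       + (\<Sum>i. ?r * emeasure (return X q) (F i))"
      by (subst suminf_add) (simp_all add: mult.commute del: emeasure_return)
    \<comment> \<open>All terms are nonnegative, so sum and integral may be exchanged; additivity of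
      each Dirac measure then finishes both summands.\<close>
    also have "\<dots> = ?m (\<Union>i. F i)"
      by (subst nn_integral_suminf[symmetric]) (simp_all add: suminf_return mult.commute del: emeasure_return)
    finally show "(\<Sum>i. ?m (F i)) = ?m (\<Union>i. F i)" .
  qed
  then have "emeasure (accept_reject_kernel X V S \<alpha> q) A = ?m A"
    unfolding accept_reject_kernel_def
    by (intro emeasure_measure_of_sigma)
      (auto simp: positive_def sets.sigma_algebra_axioms A)
  then show ?thesis using A by simp
qed

lemma sets_accept_reject_kernel: "sets (accept_reject_kernel X V S \<alpha> q) = sets X"
  by (simp add: accept_reject_kernel_def)

text \<open>The acceptance and rejection weights add up to 1, which gives total mass 1.
  Measurability in \<open>q\<close> is tested on each set \<open>A\<close>, where the value is built
  from integrals against \<open>V q\<close> of jointly measurable functions.\<close>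

lemma measurable_accept_reject_kernel:
  "accept_reject_kernel X V S \<alpha> \<in> X \<rightarrow>\<^sub>M prob_algebra X"
proof (rule measurable_prob_algebraI)
  show *: "prob_space (accept_reject_kernel X V S \<alpha> q)" if q[measurable]: "q \<in> space X" for q
  proof (rule prob_spaceI)
    note [measurable_cong] = V_kernel(1)[OF q]
    interpret Vq: prob_space "V q" using q by (rule V_kernel)
    \<comment> \<open>The proposed state stays in \<open>space X\<close>, so no accepted mass is
      lost.\<close>
    have "fst (S (q, v)) \<in> space X" if "v \<in> space (V q)" for v
      using that measurable_space[OF S, of "(q, v)"] q
      by (auto simp: space_pair_measure sets_eq_imp_space_eq[OF V_kernel(1)[OF q]])
    then have "emeasure (accept_reject_kernel X V S \<alpha> q) (space X)
        = (\<integral>\<^sup>+v. ennreal (\<alpha> (q, v)) \<partial>V q) + (\<integral>\<^sup>+v. ennreal (1 - \<alpha> (q, v)) \<partial>V q)"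
      using q by (auto simp: emeasure_accept_reject_kernel intro!: nn_integral_cong)
    also have "\<dots> = (\<integral>\<^sup>+v. ennreal (\<alpha> (q, v)) + ennreal (1 - \<alpha> (q, v)) \<partial>V q)"
      by (rule nn_integral_add[symmetric]) simp_all
    \<comment> \<open>Since \<open>ennreal\<close> cuts negative reals off at 0, it respects the sum
      of \<open>\<alpha>\<close> and \<open>1 - \<alpha>\<close> here thanks to the bounds
      \<open>\<alpha>_01\<close>.\<close>
    also have "\<dots> = 1"
      by (simp add: \<alpha>_01 Vq.emeasure_space_1 flip: ennreal_plus)
    finally show "emeasure (accept_reject_kernel X V S \<alpha> q) (space (accept_reject_kernel X V S \<alpha> q)) = 1"
      by (simp add: sets_eq_imp_space_eq[OF sets_accept_reject_kernel])
  qed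
  show "accept_reject_kernel X V S \<alpha> \<in> X \<rightarrow>\<^sub>M subprob_algebra X"
  proof (rule measurable_subprob_algebra)
    fix A assume A[measurable]: "A \<in> sets X"
    have [measurable]:
      "(\<lambda>q. \<integral>\<^sup>+v. ennreal (\<alpha> (q, v)) * indicator A (fst (S (q, v))) \<partial>V q) \<in> borel_measurable X"
      "(\<lambda>q. \<integral>\<^sup>+v. ennreal (1 - \<alpha> (q, v)) \<partial>V q) \<in> borel_measurable X"
      by (rule measurable_nn_integral_V; measurable)+
    have "(\<lambda>q. (\<integral>\<^sup>+v. ennreal (\<alpha> (q, v)) * indicator A (fst (S (q, v))) \<partial>V q)
        + indicator A q * (\<integral>\<^sup>+v. ennreal (1 - \<alpha> (q, v)) \<partial>V q)) \<in> borel_measurable X"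
      by measurable
    then show "(\<lambda>q. emeasure (accept_reject_kernel X V S \<alpha> q) A) \<in> borel_measurable X"
      by (rule measurable_cong[THEN iffD1, rotated]) (simp add: emeasure_accept_reject_kernel)
  qed (simp_all add: * prob_space_imp_subprob_space sets_accept_reject_kernel)
qed

text \<open>The acceptance rule enters through \<open>sym\<close>, which says that the measure with
  density \<open>\<alpha>\<close> with respect to the kernel product is invariant under
  \<open>S\<close>. Reversibility follows for every acceptance function with this property.\<close>

lemma detailed_balance_accept_reject_kernel:
  assumes \<mu>: "prob_space \<mu>" "sets \<mu> = sets X"
    and inv: "\<And>z. z \<in> space (X \<Otimes>\<^sub>M Y) \<Longrightarrow> S (S z) = z"
    and sym: "\<And>g. g \<in> borel_measurable (X \<Otimes>\<^sub>M Y) \<Longrightarrow>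
      (\<integral>\<^sup>+z. ennreal (\<alpha> z) * g (S z) \<partial>kernel_product X Y \<mu> V)
      = (\<integral>\<^sup>+z. ennreal (\<alpha> z) * g z \<partial>kernel_product X Y \<mu> V)"
  shows "detailed_balance X \<mu> (accept_reject_kernel X V S \<alpha>)"
  unfolding detailed_balance_def
proof (rule measure_eqI)
  let ?P = "accept_reject_kernel X V S \<alpha>" and ?M = "kernel_product X Y \<mu> V"
  let ?N = "kernel_product X X \<mu> ?P" and ?swap = "\<lambda>(q', q). (q, q')"
  note P = measurable_accept_reject_kernel
  note sN = sets_kernel_product[OF \<mu> P]
  note [measurable_cong] = \<mu>(2) sN
  note space_\<mu> = sets_eq_imp_space_eq[OF \<mu>(2)]
  show "sets ?N = sets (distr ?N (X \<Otimes>\<^sub>M X) ?swap)" by (simp add: sN)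
  \<comment> \<open>The joint law of current and next state splits into an accepted part, integrated
    over the extended space, and a rejected part on the diagonal.\<close>
  have N: "emeasure ?N A = (\<integral>\<^sup>+z. ennreal (\<alpha> z) * indicator A (fst z, fst (S z)) \<partial>?M)
       + (\<integral>\<^sup>+q. indicator A (q, q) * (\<integral>\<^sup>+v. ennreal (1 - \<alpha> (q, v)) \<partial>V q) \<partial>\<mu>)"
    if [measurable]: "A \<in> sets (X \<Otimes>\<^sub>M X)" for A
  proof -
    have [measurable]:
      "(\<lambda>q. \<integral>\<^sup>+v. ennreal (\<alpha> (q, v)) * indicator A (q, fst (S (q, v))) \<partial>V q) \<in> borel_measurable X"
      "(\<lambda>q. \<integral>\<^sup>+v. ennreal (1 - \<alpha> (q, v)) \<partial>V q) \<in> borel_measurable X"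
      by (rule measurable_nn_integral_V; measurable)+
    have "emeasure ?N A = (\<integral>\<^sup>+q. emeasure (?P q) (Pair q -` A) \<partial>\<mu>)"
      by (rule emeasure_kernel_product[OF \<mu> P that])
    also have "\<dots> = (\<integral>\<^sup>+q. (\<integral>\<^sup>+v. ennreal (\<alpha> (q, v)) * indicator A (q, fst (S (q, v))) \<partial>V q)
       + indicator A (q, q) * (\<integral>\<^sup>+v. ennreal (1 - \<alpha> (q, v)) \<partial>V q) \<partial>\<mu>)"
      by (intro nn_integral_cong)
        (simp add: space_\<mu> emeasure_accept_reject_kernel sets_Pair1[OF that] indicator_def)
    also have "\<dots> = (\<integral>\<^sup>+q. \<integral>\<^sup>+v. ennreal (\<alpha> (q, v)) * indicator A (q, fst (S (q, v))) \<partial>V q \<partial>\<mu>)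
       + (\<integral>\<^sup>+q. indicator A (q, q) * (\<integral>\<^sup>+v. ennreal (1 - \<alpha> (q, v)) \<partial>V q) \<partial>\<mu>)"
      by (rule nn_integral_add) measurable
    also have "(\<integral>\<^sup>+q. \<integral>\<^sup>+v. ennreal (\<alpha> (q, v)) * indicator A (q, fst (S (q, v))) \<partial>V q \<partial>\<mu>)
       = (\<integral>\<^sup>+z. ennreal (\<alpha> z) * indicator A (fst z, fst (S z)) \<partial>?M)"
      by (subst nn_integral_kernel_product[OF \<mu> V]) simp_all
    finally show ?thesis .
  qed
  fix A assume "A \<in> sets ?N"
  then have A[measurable]: "A \<in> sets (X \<Otimes>\<^sub>M X)" by (simp add: sN)
  let ?B = "?swap -` A \<inter> space (X \<Otimes>\<^sub>M X)"
  have B: "?B \<in> sets (X \<Otimes>\<^sub>M X)" by measurable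
  have space_M: "space ?M = space (X \<Otimes>\<^sub>M Y)"
    by (rule sets_eq_imp_space_eq[OF sets_kernel_product[OF \<mu> V]])
  have fst_space: "fst z \<in> space X" "fst (S z) \<in> space X" if "z \<in> space (X \<Otimes>\<^sub>M Y)" for z
    using that measurable_space[OF S that] by (auto simp: space_pair_measure)
  \<comment> \<open>After the swap the first coordinate is \<open>fst (S z)\<close> and the second
    is \<open>fst z\<close>, rewritten as \<open>fst (S (S z))\<close>. The indicator thus becomes a
    function of \<open>S z\<close>, and \<open>sym\<close> removes this \<open>S\<close>.\<close>
  have "(\<integral>\<^sup>+z. ennreal (\<alpha> z) * indicator ?B (fst z, fst (S z)) \<partial>?M)
      = (\<integral>\<^sup>+z. ennreal (\<alpha> z) * indicator A (fst (S z), fst (S (S z))) \<partial>?M)"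
    by (intro nn_integral_cong)
      (simp add: space_M inv indicator_def space_pair_measure[of X X] fst_space)
  also have "\<dots> = (\<integral>\<^sup>+z. ennreal (\<alpha> z) * indicator A (fst z, fst (S z)) \<partial>?M)"
    by (rule sym) simp
  finally have acc: "(\<integral>\<^sup>+z. ennreal (\<alpha> z) * indicator ?B (fst z, fst (S z)) \<partial>?M)
      = (\<integral>\<^sup>+z. ennreal (\<alpha> z) * indicator A (fst z, fst (S z)) \<partial>?M)" .
  \<comment> \<open>The swap fixes every point of the diagonal.\<close>
  have rej: "(\<integral>\<^sup>+q. indicator ?B (q, q) * (\<integral>\<^sup>+v. ennreal (1 - \<alpha> (q, v)) \<partial>V q) \<partial>\<mu>)
      = (\<integral>\<^sup>+q. indicator A (q, q) * (\<integral>\<^sup>+v. ennreal (1 - \<alpha> (q, v)) \<partial>V q) \<partial>\<mu>)"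
    by (intro nn_integral_cong) (simp add: space_\<mu> indicator_def space_pair_measure)
  have "emeasure (distr ?N (X \<Otimes>\<^sub>M X) ?swap) A = emeasure ?N ?B"
    by (subst emeasure_distr) (simp_all add: sets_eq_imp_space_eq[OF sN])
  also have "\<dots> = emeasure ?N A"
    unfolding N[OF A] N[OF B] acc rej ..
  finally show "emeasure ?N A = emeasure (distr ?N (X \<Otimes>\<^sub>M X) ?swap) A" ..
qed

end

section \<open>The acceptance probability given by the Radon-Nikodym derivative\<close>

theorem theorem2p1:
  fixes X \<mu> :: "'a measure" and Y :: "'b measure"
    and V :: "'a \<Rightarrow> 'b measure"
    and \<M> :: "('a \<times> 'b) measure"
    and S :: "'a \<times> 'b \<Rightarrow> 'a \<times> 'b"
    and \<rho> :: "'a \<times> 'b \<Rightarrow> ennreal"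
    and \<alpha> :: "'a \<times> 'b \<Rightarrow> real"
    and P :: "'a \<Rightarrow> 'a measure"
  assumes "prob_space \<mu>" and "sets \<mu> = sets X"
    and "V \<in> X \<rightarrow>\<^sub>M prob_algebra Y"
    and "\<M> = kernel_product X Y \<mu> V"
    and "S \<in> X \<Otimes>\<^sub>M Y \<rightarrow>\<^sub>M X \<Otimes>\<^sub>M Y"
    and P1: "\<forall>z \<in> space (X \<Otimes>\<^sub>M Y). S (S z) = z"
    and P2: "absolutely_continuous \<M> (distr \<M> (X \<Otimes>\<^sub>M Y) S)"
    and "\<rho> \<in> borel_measurable (X \<Otimes>\<^sub>M Y)"
    and "AE z in \<M>. \<rho> z = RN_deriv \<M> (distr \<M> (X \<Otimes>\<^sub>M Y) S) z"
    and "\<alpha> = accept_prob \<rho>"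
    and "P = accept_reject_kernel X V S \<alpha>"
  shows "P \<in> X \<rightarrow>\<^sub>M prob_algebra X \<and> detailed_balance X \<mu> P \<and> invariant_measure \<mu> P"
proof -
  note V = assms(3) and S[measurable] = assms(5) and \<rho>[measurable] = assms(8)
  note sets_M = sets_kernel_product[OF assms(1,2) V, folded assms(4)]
  interpret M: prob_space \<M>
    unfolding assms(4) by (rule prob_space_kernel_product[OF assms(1,2) V])
  have distr_M: "distr \<M> (X \<Otimes>\<^sub>M Y) S = distr \<M> \<M> S"
    by (intro distr_cong) (simp_all add: sets_M)
  \<comment> \<open>Densities that agree almost everywhere define the same measure, so any version
    \<open>\<rho>\<close> of the derivative may be used.\<close>
  have "density \<M> \<rho> = density \<M> (RN_deriv \<M> (distr \<M> (X \<Otimes>\<^sub>M Y) S))"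
    using assms(9) borel_measurable_RN_deriv[of \<M> "distr \<M> (X \<Otimes>\<^sub>M Y) S"]
    by (intro density_cong) (simp_all add: measurable_cong_sets[OF sets_M refl])
  \<comment> \<open>The Radon-Nikodym theorem, with the absolute continuity
    \<open>P2\<close>.\<close>
  also have "\<dots> = distr \<M> \<M> S"
    using M.density_RN_deriv[OF P2] by (simp add: sets_M distr_M)
  finally have dens: "density \<M> \<rho> = distr \<M> \<M> S" .
  have S_M: "S \<in> \<M> \<rightarrow>\<^sub>M \<M>"
    using S by (simp add: measurable_cong_sets[OF sets_M sets_M])
  have \<alpha>_meas: "\<alpha> \<in> borel_measurable (X \<Otimes>\<^sub>M Y)"
    unfolding assms(10) accept_prob_def by measurable
  \<comment> \<open>The minimum is at most 1, hence finite, so the passage through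
    \<open>real\<close> loses nothing, even where \<open>\<rho>\<close> is infinite.\<close>
  have ennreal_\<alpha>: "ennreal (\<alpha> z) = min 1 (\<rho> z)" for z
    unfolding assms(10) accept_prob_def by (simp add: min_less_iff_disj)
  have \<alpha>_01: "0 \<le> \<alpha> z" "\<alpha> z \<le> 1" for z
    using ennreal_\<alpha>[of z] by (simp_all add: assms(10) accept_prob_def flip: ennreal_le_1)
  have P: "P \<in> X \<rightarrow>\<^sub>M prob_algebra X"
    unfolding assms(11) by (rule measurable_accept_reject_kernel[OF V S \<alpha>_meas \<alpha>_01])
  have "detailed_balance X \<mu> P"
    unfolding assms(11)
  proof (rule detailed_balance_accept_reject_kernel[OF V S \<alpha>_meas \<alpha>_01 assms(1,2)], goal_cases)
    \<comment> \<open>This is the symmetry hypothesis \<open>sym\<close>, now an instance of the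
      invariance under the involution, with \<open>\<alpha>\<close> read as
      \<open>min 1 \<rho>\<close>.\<close>
    case (2 g)
    then show ?case
      unfolding ennreal_\<alpha> assms(4)[symmetric] using P1 dens
      by (intro M.nn_integral_involution[OF S_M])
        (simp_all add: measurable_cong_sets[OF sets_M refl] sets_eq_imp_space_eq[OF sets_M])
  qed (simp add: P1)
  with P detailed_balance_imp_invariant[OF assms(1,2) P] show ?thesis by blast
qed

end
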